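(* For all $r \in \mathbb{N}_{>0}$, $k \in \mathbb{N}$ and $m \in \mathbb{N}_{>0}$, the following hold: $$\mathcal{M}_r(k,m) \le \frac{(r!)^m}{(mr-1)!}\int_0^m x^k (m-x)^{mr-1}\,dx = \frac{k!\,(r!)^m\, m^{k+rm}}{(k+mr)!},$$ and $$\mathcal{M}_r(k,m) \ge \frac{(r!)^m}{(mr-1)!}\int_{m-1}^m x^k (m-x)^{mr-1}\,dx \ge \frac{k!\,(r!)^m\, m^{k+mr}}{(k+mr)!}\left(1 - \frac{(m-1)^k}{m^{k+mr}}\sum_{i=1}^{mr}\binom{k+mr}{k+i}(m-1)^i\right).$$ Moreover, for all fixed $r, m \in \mathbb{N}_{>0}$, $$\lim_{k\to+\infty} \frac{(m-1)^k}{m^{k+mr}}\sum_{i=1}^{mr}\binom{k+mr}{k+i}(m-1)^i = 0.$$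
   Context: $\mathbb{N}$ denotes the nonnegative integers and $\mathbb{N}_{>0}$ the positive integers; $0^0 = 1$. For $r \in \mathbb{N}_{>0}$, the beta distribution with parameters $(1,r)$ is the probability distribution on $\mathbb{R}$ with density $g_r(x) = r(1-x)^{r-1}$ if $x \in [0,1]$ and $g_r(x) = 0$ otherwise. For $k \in \mathbb{N}$ and $m \in \mathbb{N}_{>0}$, define $$\mathcal{M}_r(k,m) = \mathbb{E}\left[(X_1+\dots+X_m)^k\right],$$ where $X_1,\dots,X_m$ are independent random variables each having the beta$(1,r)$ distribution. *)

theory Defs
  imports "HOL-Probability.Probability"
begin

definition beta1_density :: "nat \<Rightarrow> real \<Rightarrow> real" where
  "beta1_density r x = (if x \<in> {0..1} then real r * (1 - x) ^ (r - 1) else 0)"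

definition beta1_measure :: "nat \<Rightarrow> real measure" where
  "beta1_measure r = density lborel (\<lambda>x. ennreal (beta1_density r x))"

text \<open>
  The moment \<open>E[(X\<^sub>1 + \<dots> + X\<^sub>m)^k]\<close> of independent \<open>X\<^sub>i\<close> with the beta distribution of
  parameters \<open>(1, r)\<close> is taken on the canonical product space, where \<open>X\<^sub>i\<close> is the \<open>i\<close>-th
  coordinate.  It is the same for every other choice of probability space and independent
  variables: see \<open>beta1_sum_moment_eq_expectation\<close>.
\<close>
definition beta1_sum_moment :: "nat \<Rightarrow> nat \<Rightarrow> nat \<Rightarrow> real" where
  "beta1_sum_moment r k m =
     (LINT x | (\<Pi>\<^sub>M i\<in>{1..m}. beta1_measure r). (\<Sum>i=1..m. x i) ^ k)"

lemma beta1_density_nonneg: "0 \<le> beta1_density r x"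
  by (simp add: beta1_density_def)

lemma beta1_density_measurable [measurable]: "beta1_density r \<in> borel_measurable borel"
  unfolding beta1_density_def by measurable

lemma sets_beta1_measure [simp, measurable_cong]: "sets (beta1_measure r) = sets borel"
  by (simp add: beta1_measure_def)

lemma space_beta1_measure [simp]: "space (beta1_measure r) = UNIV"
  by (simp add: beta1_measure_def)

lemma prob_space_beta1_measure:
  assumes "r > 0"
  shows "prob_space (beta1_measure r)"
proof
  let ?F = "\<lambda>x::real. - ((1 - x) ^ r)"
  have "emeasure (beta1_measure r) (space (beta1_measure r))
      = (\<integral>\<^sup>+x. ennreal (real r * (1 - x) ^ (r - 1)) * indicator {0..1} x \<partial>lborel)"
    by (auto simp: beta1_measure_def emeasure_density beta1_density_def
             intro!: nn_integral_cong split: split_indicator)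
  also have "\<dots> = ennreal (?F 1 - ?F 0)"
    by (intro nn_integral_FTC_Icc) (auto intro!: derivative_eq_intros)
  also have "\<dots> = 1"
    using assms by (simp add: power_0_left)
  finally show "emeasure (beta1_measure r) (space (beta1_measure r)) = 1" .
qed

lemma beta1_sum_moment_eq_expectation:
  assumes "prob_space M" and "m > 0"
    and indep: "prob_space.indep_vars M (\<lambda>_. borel) X {1..m}"
    and distr: "\<And>i. i \<in> {1..m} \<Longrightarrow> distributed M lborel (X i) (beta1_density r)"
  shows "beta1_sum_moment r k m = prob_space.expectation M (\<lambda>\<omega>. (\<Sum>i=1..m. X i \<omega>) ^ k)"
proof -
  interpret prob_space M by fact
  have X [measurable]: "X i \<in> borel_measurable M" if "i \<in> {1..m}" for i
    using distributed_measurable[OF distr[OF that]] by simp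
  have D: "distr M borel (X i) = beta1_measure r" if "i \<in> {1..m}" for i
  proof -
    have "distr M borel (X i) = distr M lborel (X i)"
      by (rule distr_cong) auto
    also have "\<dots> = beta1_measure r"
      using distributed_distr_eq_density[OF distr[OF that]] by (simp add: beta1_measure_def)
    finally show ?thesis .
  qed
  have "distr M (\<Pi>\<^sub>M i\<in>{1..m}. borel) (\<lambda>x. \<lambda>i\<in>{1..m}. X i x)
      = (\<Pi>\<^sub>M i\<in>{1..m}. distr M borel (X i))"
    using indep_vars_iff_distr_eq_PiM'[of "{1..m}" X "\<lambda>_. borel"] indep X \<open>m > 0\<close> by auto
  also have "\<dots> = (\<Pi>\<^sub>M i\<in>{1..m}. beta1_measure r)"
    using D by (intro PiM_cong) auto
  finally have P: "(\<Pi>\<^sub>M i\<in>{1..m}. beta1_measure r)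
      = distr M (\<Pi>\<^sub>M i\<in>{1..m}. borel) (\<lambda>x. \<lambda>i\<in>{1..m}. X i x)" ..
  show ?thesis
    unfolding beta1_sum_moment_def P
    by (subst integral_distr) (auto intro!: measurable_restrict X)
qed

lemma integrable_beta1_sum_power:
  fixes m :: nat
  assumes "r > 0"
  shows "integrable (\<Pi>\<^sub>M i\<in>{1..m}. beta1_measure r) (\<lambda>x. (\<Sum>i=1..m. x i) ^ k)"
proof -
  interpret B: prob_space "beta1_measure r" by (rule prob_space_beta1_measure) fact
  interpret product_prob_space "\<lambda>_. beta1_measure r" "{1..m}" by unfold_locales
  have ae: "AE y in beta1_measure r. y \<in> {0..1}"
    unfolding beta1_measure_def
    by (subst AE_density) (auto simp: beta1_density_def split: if_splits)
  have "AE x in (\<Pi>\<^sub>M i\<in>{1..m}. beta1_measure r). \<forall>i\<in>{1..m}. x i \<in> {0..1}"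
    by (intro AE_ball_countable' AE_component ae) auto
  then have "AE x in (\<Pi>\<^sub>M i\<in>{1..m}. beta1_measure r). norm ((\<Sum>i=1..m. x i) ^ k) \<le> real m ^ k"
  proof (eventually_elim)
    case (elim x)
    have "0 \<le> (\<Sum>i=1..m. x i)" using elim by (intro sum_nonneg) auto
    moreover have "(\<Sum>i=1..m. x i) \<le> (\<Sum>i=1..m. 1)" using elim by (intro sum_mono) auto
    ultimately show ?case by (auto intro!: power_mono simp: abs_of_nonneg)
  qed
  then show ?thesis
    by (intro P.integrable_const_bound) auto
qed

end

theory Submission
  imports Defs "HOL-Real_Asymp.Real_Asymp"
begin

text \<open>
  Put \<open>Y\<^sub>i = 1 - X\<^sub>i\<close>. On \<open>[0,1]\<close> the density of \<open>Y\<^sub>i\<close> agrees with \<open>r!\<close> times \<open>t^(r-1) / (r-1)!\<close>, and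
  the kernels \<open>t^n / n!\<close> on \<open>[0,\<infinity>)\<close> form a convolution semigroup. Hence \<open>Y\<^sub>1 + \<dots> + Y\<^sub>m\<close> has a density
  that is at most \<open>(r!)^m t^(mr-1) / (mr-1)!\<close>, with equality on \<open>[0,1]\<close>, where cutting each factor off
  at \<open>1\<close> has no effect. The substitution \<open>x = m - t\<close> gives both bounds on the moments.
\<close>

section \<open>Beta integrals on \<open>{0..a}\<close>\<close>

text \<open>Integration by parts trades one factor \<open>a - x\<close> for one factor
  \<open>x\<close>. The induction on \<open>j\<close> therefore keeps \<open>k\<close> arbitrary and
  uses the hypothesis at \<open>Suc k\<close>.\<close>

lemma has_integral_power_mult_power:
  fixes a :: real
  assumes "0 \<le> a"
  shows "((\<lambda>x. x ^ k * (a - x) ^ j) has_integral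
           (fact k * fact j / fact (k + j + 1) * a ^ (k + j + 1))) {0..a}"
proof (induction j arbitrary: k)
  case 0
  let ?F = "\<lambda>x::real. x ^ Suc k / real (Suc k)"
  have "((\<lambda>x. x ^ k) has_integral (?F a - ?F 0)) {0..a}"
  proof (rule fundamental_theorem_of_calculus[OF assms])
    fix x :: real
    have "(?F has_real_derivative x ^ k) (at x within {0..a})"
      by (rule derivative_eq_intros refl | simp)+
    then show "(?F has_vector_derivative x ^ k) (at x within {0..a})"
      by (simp add: has_real_derivative_iff_has_vector_derivative)
  qed
  moreover have "?F a - ?F 0 = fact k * fact 0 / fact (k + 0 + 1) * a ^ (k + 0 + 1)"
    by simp
  ultimately show ?case by simp
next
  case (Suc j)
  let ?F = "\<lambda>x::real. x ^ Suc k * (a - x) ^ Suc j / real (Suc k)"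
  let ?c = "real (Suc j) / real (Suc k)"
  let ?g = "\<lambda>x. x ^ k * (a - x) ^ Suc j - ?c * (x ^ Suc k * (a - x) ^ j)"
  have "(?g has_integral (?F a - ?F 0)) {0..a}"
  proof (rule fundamental_theorem_of_calculus[OF assms])
    fix x :: real
    have "(?F has_real_derivative
        ((real (Suc k) * x ^ k * (a - x) ^ Suc j
          - x ^ Suc k * (real (Suc j) * (a - x) ^ j)) / real (Suc k))) (at x within {0..a})"
      by (rule derivative_eq_intros refl | simp)+
    also have "(real (Suc k) * x ^ k * (a - x) ^ Suc j
          - x ^ Suc k * (real (Suc j) * (a - x) ^ j)) / real (Suc k) = ?g x"
      by (simp add: diff_divide_distrib del: of_nat_Suc power_Suc)
    finally show "(?F has_vector_derivative ?g x) (at x within {0..a})"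
      by (simp add: has_real_derivative_iff_has_vector_derivative)
  qed
  \<comment> \<open>Adding \<open>?c\<close> times the induction hypothesis cancels the subtracted
    term of \<open>?g\<close>. The boundary term disappears because \<open>?F\<close> vanishes at
    both \<open>0\<close> and \<open>a\<close>.\<close>
  from has_integral_add[OF this has_integral_mult_right[OF Suc.IH[of "Suc k"], of ?c]]
  have "((\<lambda>x. x ^ k * (a - x) ^ Suc j) has_integral
      ?c * (fact (Suc k) * fact j / fact (Suc k + j + 1) * a ^ (Suc k + j + 1))) {0..a}"
    by simp
  moreover have "?c * (fact (Suc k) * fact j / fact (Suc k + j + 1) * a ^ (Suc k + j + 1))
      = fact k * fact (Suc j) / fact (k + Suc j + 1) * a ^ (k + Suc j + 1)"
    by (simp only: fact_Suc[of k] fact_Suc[of j]) (simp add: field_simps del: of_nat_Suc fact_Suc)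
  ultimately show ?case by (simp only:)
qed

section \<open>The convolution semigroup of truncated powers\<close>

text \<open>This is the Riemann-Liouville kernel of order \<open>n + 1\<close>, the
  \<open>(n + 1)\<close>-fold convolution power of the indicator of the half-line. Indexing by the
  exponent instead of the order is what produces the \<open>+ 1\<close> in the convolution
  rule.\<close>

definition trunc_pow :: "nat \<Rightarrow> real \<Rightarrow> real" where
  "trunc_pow n x = (if 0 \<le> x then x ^ n / fact n else 0)"

lemma trunc_pow_nonneg: "0 \<le> trunc_pow n x"
  by (simp add: trunc_pow_def)

lemma trunc_pow_measurable [measurable]: "trunc_pow n \<in> borel_measurable borel"
  unfolding trunc_pow_def by measurable

text \<open>Both factors are nonzero only if \<open>0 <= u <= t\<close>, so the convolution is a
  beta integral over \<open>{0..t}\<close> when \<open>t >= 0\<close>, and zero otherwise.\<close>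

lemma nn_integral_trunc_pow_convolution:
  "(\<integral>\<^sup>+u. ennreal (trunc_pow a u) * ennreal (trunc_pow b (t - u)) \<partial>lborel)
    = ennreal (trunc_pow (a + b + 1) t)"
proof (cases "0 \<le> t")
  case True
  have "(\<integral>\<^sup>+u. ennreal (trunc_pow a u) * ennreal (trunc_pow b (t - u)) \<partial>lborel)
      = (\<integral>\<^sup>+u. ennreal (u ^ a * (t - u) ^ b / (fact a * fact b)) * indicator {0..t} u \<partial>lborel)"
    by (intro nn_integral_cong)
      (auto simp: trunc_pow_def indicator_def simp flip: ennreal_mult)
  also have "\<dots> = ennreal (fact a * fact b / fact (a + b + 1) * t ^ (a + b + 1) / (fact a * fact b))"
    by (intro nn_integral_has_integral_lebesgue' has_integral_divide
          has_integral_power_mult_power True) auto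
  also have "\<dots> = ennreal (trunc_pow (a + b + 1) t)"
    using True by (simp add: trunc_pow_def)
  finally show ?thesis .
next
  case False
  then have "(\<integral>\<^sup>+u. ennreal (trunc_pow a u) * ennreal (trunc_pow b (t - u)) \<partial>lborel)
      = (\<integral>\<^sup>+(u::real). 0 \<partial>lborel)"
    by (intro nn_integral_cong) (auto simp: trunc_pow_def)
  then show ?thesis using False by (simp add: trunc_pow_def)
qed

section \<open>The law of the sum of the variables \<open>1 - x i\<close>\<close>

text \<open>Reflecting by \<open>u = 1 - y\<close> turns the density into
  \<open>r * u ^ (r - 1)\<close> on \<open>{0..1}\<close>, and
  \<open>r = fact r / fact (r - 1)\<close>. The cutoff at \<open>1\<close> stays a separate factor,
  to be dropped for the upper bound and shown harmless for the equality.\<close>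

lemma nn_integral_beta1_measure:
  assumes "r > 0" and [measurable]: "F \<in> borel_measurable borel"
  shows "(\<integral>\<^sup>+y. F (1 - y) \<partial>beta1_measure r)
    = fact r * (\<integral>\<^sup>+u. ennreal (trunc_pow (r - 1) u) * F u * indicator {..1} u \<partial>lborel)"
proof -
  obtain q where r: "r = Suc q" using assms(1) gr0_implies_Suc by blast
  have "(\<integral>\<^sup>+y. F (1 - y) \<partial>beta1_measure r)
      = (\<integral>\<^sup>+y. ennreal (beta1_density r y) * F (1 - y) \<partial>lborel)"
    unfolding beta1_measure_def by (subst nn_integral_density) auto
  also have "\<dots> = (\<integral>\<^sup>+u. ennreal (beta1_density r (1 - u)) * F u \<partial>lborel)"
    by (subst nn_integral_real_affine[where c="-1" and t=1]) auto
  also have "\<dots> = (\<integral>\<^sup>+u. fact r * (ennreal (trunc_pow (r - 1) u) * F u * indicator {..1} u) \<partial>lborel)"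
  proof (intro nn_integral_cong)
    fix u
    have "beta1_density r (1 - u) = fact r * (trunc_pow (r - 1) u * indicator {..1} u)"
      by (auto simp: beta1_density_def trunc_pow_def indicator_def r)
    then have "ennreal (beta1_density r (1 - u))
        = fact r * (ennreal (trunc_pow (r - 1) u) * indicator {..1} u)"
      by (auto simp add: ennreal_mult trunc_pow_nonneg indicator_def simp flip: ennreal_fact)
    then show "ennreal (beta1_density r (1 - u)) * F u
        = fact r * (ennreal (trunc_pow (r - 1) u) * F u * indicator {..1} u)"
      by (simp add: mult_ac)
  qed
  finally show ?thesis by (simp add: nn_integral_cmult)
qed

text \<open>Translating by \<open>u\<close> and exchanging the integrals leaves a convolution of two
  kernels inside. This absorbs one more summand in the induction over the index set.\<close>

lemma nn_integral_trunc_pow_mix: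
  assumes [measurable]: "f \<in> borel_measurable borel"
  shows "(\<integral>\<^sup>+u. ennreal (trunc_pow a u) * (\<integral>\<^sup>+s. ennreal (trunc_pow b s) * f (s + u) \<partial>lborel) \<partial>lborel)
    = (\<integral>\<^sup>+t. ennreal (trunc_pow (a + b + 1) t) * f t \<partial>lborel)"
proof -
  have "(\<integral>\<^sup>+s. ennreal (trunc_pow b s) * f (s + u) \<partial>lborel)
      = (\<integral>\<^sup>+t. ennreal (trunc_pow b (t - u)) * f t \<partial>lborel)" for u
    by (subst nn_integral_real_affine[where c=1 and t="-u"]) (auto simp: algebra_simps)
  then have "(\<integral>\<^sup>+u. ennreal (trunc_pow a u) * (\<integral>\<^sup>+s. ennreal (trunc_pow b s) * f (s + u) \<partial>lborel) \<partial>lborel)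
      = (\<integral>\<^sup>+u. (\<integral>\<^sup>+t. ennreal (trunc_pow a u) * (ennreal (trunc_pow b (t - u)) * f t) \<partial>lborel) \<partial>lborel)"
    by (simp add: nn_integral_cmult)
  also have "\<dots> = (\<integral>\<^sup>+t. (\<integral>\<^sup>+u. ennreal (trunc_pow a u) * (ennreal (trunc_pow b (t - u)) * f t) \<partial>lborel) \<partial>lborel)"
    by (rule lborel_pair.Fubini') measurable
  also have "\<dots> = (\<integral>\<^sup>+t. (\<integral>\<^sup>+u. ennreal (trunc_pow a u) * ennreal (trunc_pow b (t - u)) \<partial>lborel) * f t \<partial>lborel)"
    by (simp add: nn_integral_multc flip: mult.assoc)
  finally show ?thesis by (simp only: nn_integral_trunc_pow_convolution)
qed

text \<open>Induction on \<open>I\<close>, integrating out one coordinate at a time. The function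
  \<open>f\<close> stays arbitrary because the hypothesis is applied to its translates. The base
  case is a singleton, since the empty sum is a point mass and has no density.\<close>

lemma nn_integral_beta1_sum:
  fixes f :: "real \<Rightarrow> ennreal"
  assumes "r > 0" "finite I" "I \<noteq> {}" "f \<in> borel_measurable borel"
  shows nn_integral_beta1_sum_le:
      "(\<integral>\<^sup>+x. f (\<Sum>i\<in>I. 1 - x i) \<partial>(\<Pi>\<^sub>M i\<in>I. beta1_measure r))
        \<le> fact r ^ card I * (\<integral>\<^sup>+t. ennreal (trunc_pow (card I * r - 1) t) * f t \<partial>lborel)" (is ?le)
    and nn_integral_beta1_sum_eq:
      "(\<And>t. t > 1 \<Longrightarrow> f t = 0) \<Longrightarrow>
       (\<integral>\<^sup>+x. f (\<Sum>i\<in>I. 1 - x i) \<partial>(\<Pi>\<^sub>M i\<in>I. beta1_measure r))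
        = fact r ^ card I * (\<integral>\<^sup>+t. ennreal (trunc_pow (card I * r - 1) t) * f t \<partial>lborel)"
proof -
  interpret B: prob_space "beta1_measure r" by (rule prob_space_beta1_measure) fact
  interpret product_sigma_finite "\<lambda>_. beta1_measure r" by unfold_locales
  let ?L = "\<lambda>I f. (\<integral>\<^sup>+x. f (\<Sum>i\<in>I. 1 - x i) \<partial>(\<Pi>\<^sub>M i\<in>I. beta1_measure r))"
  let ?R = "\<lambda>I f. fact r ^ card I
    * (\<integral>\<^sup>+t. ennreal (trunc_pow (card I * r - 1) t) * (f t :: ennreal) \<partial>lborel)"
  have "?L I f \<le> ?R I f \<and> ((\<forall>t>1. f t = 0) \<longrightarrow> ?L I f = ?R I f)"
    using assms(2-)
  proof (induction I arbitrary: f rule: finite_ne_induct)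
    case (singleton i)
    note [measurable] = singleton
    have L: "?L {i} f
        = fact r * (\<integral>\<^sup>+u. ennreal (trunc_pow (r - 1) u) * f u * indicator {..1} u \<partial>lborel)"
      using product_nn_integral_singleton[of "\<lambda>y. f (1 - y)" i]
      by (simp add: nn_integral_beta1_measure assms(1))
    have "?L {i} f \<le> ?R {i} f"
      unfolding L by (auto intro!: mult_left_mono nn_integral_mono split: split_indicator)
    moreover have "?L {i} f = ?R {i} f" if "\<forall>t>1. f t = 0"
      unfolding L using that
      by (auto intro!: arg_cong[where f="\<lambda>x. fact r * x"] nn_integral_cong split: split_indicator)
    ultimately show ?case by blast
  next
    case (insert i I)
    note [measurable] = insert.prems
    let ?n = "card I * r - 1"
    let ?J = "\<lambda>u. \<integral>\<^sup>+s. ennreal (trunc_pow ?n s) * f (s + u) \<partial>lborel"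
    \<comment> \<open>Both natural-number subtractions are exact because \<open>r > 0\<close> and
      \<open>I\<close> is nonempty.\<close>
    have n: "r - 1 + ?n + 1 = card (insert i I) * r - 1"
      using insert.hyps assms(1) by (cases r) (auto simp: Suc_diff_Suc card_gt_0_iff)
    have shift: "(\<lambda>s. f (s + u)) \<in> borel_measurable borel" for u by measurable
    have sum: "(\<Sum>j\<in>insert i I. 1 - (x(i := y)) j) = (\<Sum>j\<in>I. 1 - x j) + (1 - y)" for x y
    proof -
      have "(\<Sum>j\<in>I. 1 - (x(i := y)) j) = (\<Sum>j\<in>I. 1 - x j)"
        using insert.hyps by (intro sum.cong) auto
      then show ?thesis using insert.hyps by (simp add: add.commute)
    qed
    have L: "?L (insert i I) f = (\<integral>\<^sup>+y. ?L I (\<lambda>s. f (s + (1 - y))) \<partial>beta1_measure r)"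
      using insert.hyps by (subst product_nn_integral_insert_rev) (auto simp only: sum, measurable)
    have R: "?R (insert i I) f = fact r ^ card I * (fact r *
        (\<integral>\<^sup>+u. ennreal (trunc_pow (r - 1) u) * ?J u \<partial>lborel))"
      unfolding nn_integral_trunc_pow_mix[OF insert.prems] n using insert.hyps by (simp add: mult_ac)
    \<comment> \<open>This differs from the right-hand side of \<open>R\<close> only by the cutoff
      \<open>indicator {..1} u\<close>.\<close>
    have M: "(\<integral>\<^sup>+y. fact r ^ card I * ?J (1 - y) \<partial>beta1_measure r) = fact r ^ card I * (fact r *
        (\<integral>\<^sup>+u. ennreal (trunc_pow (r - 1) u) * ?J u * indicator {..1} u \<partial>lborel))"
      by (subst nn_integral_cmult, measurable)
        (subst nn_integral_beta1_measure[OF assms(1), of ?J, symmetric], auto)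
    have "?L (insert i I) f \<le> (\<integral>\<^sup>+y. fact r ^ card I * ?J (1 - y) \<partial>beta1_measure r)"
      unfolding L using insert.IH[OF shift] by (intro nn_integral_mono) blast
    also have "\<dots> \<le> ?R (insert i I) f"
      unfolding M R by (auto intro!: mult_left_mono nn_integral_mono split: split_indicator)
    finally have "?L (insert i I) f \<le> ?R (insert i I) f" .
    moreover have "?L (insert i I) f = ?R (insert i I) f" if f0: "\<forall>t>1. f t = 0"
    proof -
      \<comment> \<open>For \<open>y <= 1\<close>, the translate of \<open>f\<close> by
        \<open>1 - y\<close> still vanishes beyond \<open>1\<close>, so the equality part of the
        induction hypothesis applies to it.\<close>
      have "AE y in beta1_measure r. y \<le> 1"
        unfolding beta1_measure_def
        by (subst AE_density) (auto simp: beta1_density_def split: if_splits)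
      then have "?L (insert i I) f = (\<integral>\<^sup>+y. fact r ^ card I * ?J (1 - y) \<partial>beta1_measure r)"
        unfolding L
      proof (intro nn_integral_cong_AE, eventually_elim)
        case (elim y)
        then show ?case using insert.IH[OF shift, of "1 - y"] f0 by auto
      qed
      also have "\<dots> = ?R (insert i I) f"
      proof -
        \<comment> \<open>If \<open>s < 0\<close> the kernel is zero, and if \<open>s >= 0\<close>
          then \<open>s + u > 1\<close>, where \<open>f\<close> is zero. Hence the cutoff removes
          nothing.\<close>
        have "?J u = 0" if "u > 1" for u
        proof -
          have "?J u = (\<integral>\<^sup>+(s::real). 0 \<partial>lborel)"
            using that f0 by (intro nn_integral_cong) (auto simp: trunc_pow_def)
          then show ?thesis by simp
        qed
        then have "(\<integral>\<^sup>+u. ennreal (trunc_pow (r - 1) u) * ?J u * indicator {..1} u \<partial>lborel)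
            = (\<integral>\<^sup>+u. ennreal (trunc_pow (r - 1) u) * ?J u \<partial>lborel)"
          by (intro nn_integral_cong) (auto split: split_indicator)
        then show ?thesis unfolding M R by simp
      qed
      finally show ?thesis .
    qed
    ultimately show ?case by blast
  qed
  then show ?le and "(\<And>t. t > 1 \<Longrightarrow> f t = 0) \<Longrightarrow> ?L I f = ?R I f"
    by blast+
qed


section \<open>Bounds on the moments\<close>

text \<open>Substitute \<open>x = b - t\<close>. The choices \<open>c = b\<close> and
  \<open>c = 1\<close> give the integrals of the upper and the lower bound.\<close>

lemma nn_integral_trunc_pow_times_power:
  fixes b c :: real
  assumes "0 \<le> c" "c \<le> b"
  shows "(\<integral>\<^sup>+t. ennreal (trunc_pow n t) * (ennreal ((b - t) ^ k) * indicator {0..c} t) \<partial>lborel)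
    = ennreal (integral {b - c..b} (\<lambda>x. x ^ k * (b - x) ^ n) / fact n)"
proof -
  have "(\<integral>\<^sup>+t. ennreal (trunc_pow n t) * (ennreal ((b - t) ^ k) * indicator {0..c} t) \<partial>lborel)
      = (\<integral>\<^sup>+x. ennreal (trunc_pow n (b - x)) * (ennreal (x ^ k) * indicator {0..c} (b - x)) \<partial>lborel)"
    by (subst nn_integral_real_affine[where c="-1" and t=b]) auto
  also have "\<dots> = (\<integral>\<^sup>+x. ennreal (x ^ k * (b - x) ^ n / fact n) * indicator {b - c..b} x \<partial>lborel)"
    using assms by (intro nn_integral_cong)
      (auto simp: trunc_pow_def indicator_def mult.commute simp flip: ennreal_mult)
  also have "\<dots> = ennreal (integral {b - c..b} (\<lambda>x. x ^ k * (b - x) ^ n) / fact n)"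
    using assms by (intro nn_integral_has_integral_lebesgue' has_integral_divide integrable_integral
        integrable_continuous_interval) (auto intro!: continuous_intros)
  finally show ?thesis .
qed

lemma AE_beta1_sum:
  fixes m :: nat
  assumes "r > 0"
  shows "AE x in (\<Pi>\<^sub>M i\<in>{1..m}. beta1_measure r). (\<Sum>i=1..m. x i) \<in> {0..real m}"
proof -
  interpret B: prob_space "beta1_measure r" by (rule prob_space_beta1_measure) fact
  interpret product_prob_space "\<lambda>_. beta1_measure r" "{1..m}" by unfold_locales
  have "AE y in beta1_measure r. y \<in> {0..1}"
    unfolding beta1_measure_def
    by (subst AE_density) (auto simp: beta1_density_def split: if_splits)
  then have "AE x in (\<Pi>\<^sub>M i\<in>{1..m}. beta1_measure r). \<forall>i\<in>{1..m}. x i \<in> {0..1}"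
    by (intro AE_ball_countable' AE_component) auto
  then show ?thesis
  proof eventually_elim
    case (elim x)
    have "0 \<le> (\<Sum>i=1..m. x i)" using elim by (intro sum_nonneg) auto
    moreover have "(\<Sum>i=1..m. x i) \<le> (\<Sum>i=1..m. 1)" using elim by (intro sum_mono) auto
    ultimately show ?case by simp
  qed
qed

text \<open>Since \<open>ennreal\<close> sends negative reals to \<open>0\<close>, passing to the
  nonnegative integral relies on the sum being almost everywhere nonnegative.\<close>

lemma nn_integral_beta1_sum_power:
  assumes "r > 0"
  shows "(\<integral>\<^sup>+x. ennreal ((\<Sum>i=1..m. x i) ^ k) \<partial>(\<Pi>\<^sub>M i\<in>{1..m}. beta1_measure r))
    = ennreal (beta1_sum_moment r k m)"
  unfolding beta1_sum_moment_def
proof (rule nn_integral_eq_integral[OF integrable_beta1_sum_power[OF assms]])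
  show "AE x in (\<Pi>\<^sub>M i\<in>{1..m}. beta1_measure r). 0 \<le> (\<Sum>i=1..m. x i) ^ k"
    using AE_beta1_sum[OF assms] by eventually_elim simp
qed

text \<open>With \<open>t\<close> the sum of the \<open>1 - x i\<close>, the moment integrand is
  \<open>(m - t) ^ k\<close>. Cutting \<open>t\<close> off at \<open>m\<close> changes it only on a
  null set; cutting off at \<open>1\<close> makes it smaller but allows the exact formula.\<close>

lemma beta1_sum_moment_bounds:
  assumes "r > 0" "m > 0"
  shows beta1_sum_moment_le:
      "beta1_sum_moment r k m
        \<le> fact r ^ m / fact (m * r - 1)
            * integral {0..real m} (\<lambda>x. x ^ k * (real m - x) ^ (m * r - 1))" (is "?M \<le> ?U")
    and beta1_sum_moment_ge:
      "fact r ^ m / fact (m * r - 1)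
            * integral {real m - 1..real m} (\<lambda>x. x ^ k * (real m - x) ^ (m * r - 1))
        \<le> beta1_sum_moment r k m" (is "?L \<le> _")
proof -
  let ?P = "\<Pi>\<^sub>M i\<in>{1..m}. beta1_measure r"
  let ?f = "\<lambda>c t. ennreal ((real m - t) ^ k) * indicator {0..c::real} t"
  have [measurable]: "?f c \<in> borel_measurable borel" for c by measurable
  have T: "(\<Sum>i=1..m. 1 - x i) = real m - (\<Sum>i=1..m. x i)" for x :: "nat \<Rightarrow> real"
    by (simp add: sum_subtractf)
  have eq: "fact r ^ m * (\<integral>\<^sup>+t. ennreal (trunc_pow (m * r - 1) t) * ?f c t \<partial>lborel)
      = ennreal (fact r ^ m / fact (m * r - 1)
          * integral {real m - c..real m} (\<lambda>x. x ^ k * (real m - x) ^ (m * r - 1)))"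
    if "0 \<le> c" "c \<le> real m" for c
  proof -
    have "fact r ^ m = ennreal (fact r ^ m)"
      by (simp flip: ennreal_power ennreal_fact)
    then show ?thesis
      unfolding nn_integral_trunc_pow_times_power[OF that] by (simp flip: ennreal_mult')
  qed
  have nonneg: "0 \<le> fact r ^ m / fact (m * r - 1)
          * integral {real m - c..real m} (\<lambda>x. x ^ k * (real m - x) ^ (m * r - 1))"
    if "c \<le> real m" for c
    using that by (intro mult_nonneg_nonneg Henstock_Kurzweil_Integration.integral_nonneg
      integrable_continuous_interval) (auto intro!: continuous_intros)
  have "ennreal ?M = (\<integral>\<^sup>+x. ?f (real m) (\<Sum>i=1..m. 1 - x i) \<partial>?P)"
    unfolding nn_integral_beta1_sum_power[OF assms(1), symmetric]
  proof (intro nn_integral_cong_AE)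
    show "AE x in ?P. ennreal ((\<Sum>i=1..m. x i) ^ k) = ?f (real m) (\<Sum>i=1..m. 1 - x i)"
      using AE_beta1_sum[OF assms(1)] by eventually_elim (simp add: T del: One_nat_def)
  qed
  also have "\<dots> \<le> ennreal ?U"
    using nn_integral_beta1_sum_le[of r "{1..m}" "?f (real m)"] assms eq[of "real m"] by simp
  finally show "?M \<le> ?U" using nonneg[of "real m"] by simp
  have "ennreal ?L = (\<integral>\<^sup>+x. ?f 1 (\<Sum>i=1..m. 1 - x i) \<partial>?P)"
    using nn_integral_beta1_sum_eq[of r "{1..m}" "?f 1"] assms eq[of 1] by simp
  also have "\<dots> \<le> (\<integral>\<^sup>+x. ennreal ((\<Sum>i=1..m. x i) ^ k) \<partial>?P)"
    by (intro nn_integral_mono) (simp add: T del: One_nat_def split: split_indicator)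
  also have "\<dots> = ennreal ?M" by (rule nn_integral_beta1_sum_power[OF assms(1)])
  finally have "ennreal ?L \<le> ennreal ?M" .
  \<comment> \<open>Needed to return from \<open>ennreal\<close> to the reals: a negative
    \<open>?M\<close> would also be sent to \<open>0\<close>.\<close>
  moreover have "0 \<le> ?M"
    unfolding beta1_sum_moment_def
  proof (rule integral_nonneg_AE)
    show "AE x in ?P. 0 \<le> (\<Sum>i=1..m. x i) ^ k"
      using AE_beta1_sum[OF assms(1)] by eventually_elim simp
  qed
  ultimately show "?L \<le> ?M" by simp
qed

section \<open>Evaluation of the integral over the last unit interval\<close>

text \<open>Expanding \<open>(a + 1 - x)^n\<close> in powers of \<open>a - x\<close> turns the integral into a sum of beta integrals,
  so the last inequality of the theorem is in fact an equality.\<close>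
lemma has_integral_power_mult_power_shift:
  fixes a :: real
  assumes "0 \<le> a"
  shows "((\<lambda>x. x ^ k * (a + 1 - x) ^ n) has_integral
    (fact k * fact n / fact (k + n + 1) * (\<Sum>i=1..n + 1. real ((k + n + 1) choose (k + i)) * a ^ (k + i)))) {0..a}"
proof -
  have "((\<lambda>x. \<Sum>j\<le>n. real (n choose j) * (x ^ k * (a - x) ^ j)) has_integral
      (\<Sum>j\<le>n. real (n choose j) * (fact k * fact j / fact (k + j + 1) * a ^ (k + j + 1)))) {0..a}"
    by (intro has_integral_sum has_integral_mult_right has_integral_power_mult_power assms) auto
  moreover have "(\<Sum>j\<le>n. real (n choose j) * (x ^ k * (a - x) ^ j)) = x ^ k * (a + 1 - x) ^ n" for x
    using binomial_ring[of "a - x" 1 n] by (simp add: sum_distrib_left mult_ac algebra_simps)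
  moreover have "(\<Sum>j\<le>n. real (n choose j) * (fact k * fact j / fact (k + j + 1) * a ^ (k + j + 1)))
      = fact k * fact n / fact (k + n + 1) * (\<Sum>i=1..n + 1. real ((k + n + 1) choose (k + i)) * a ^ (k + i))"
  proof -
    \<comment> \<open>The terms agree one by one under \<open>i = j + 1\<close>: both binomial
      coefficients carry the same factor \<open>fact (n - j)\<close> in the denominator.\<close>
    have "real (n choose j) * (fact k * fact j / fact (k + j + 1) * a ^ (k + j + 1))
        = fact k * fact n / fact (k + n + 1) * (real ((k + n + 1) choose (k + (j + 1))) * a ^ (k + (j + 1)))"
      if "j \<le> n" for j
    proof -
      have "real ((k + n + 1) choose (k + (j + 1))) = fact (k + n + 1) / (fact (k + j + 1) * fact (n - j))"
        using that by (subst binomial_fact) (auto simp: add.assoc)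
      moreover have "real (n choose j) = fact n / (fact j * fact (n - j))"
        by (rule binomial_fact[OF that])
      ultimately show ?thesis by (simp add: mult_ac del: fact_Suc binomial_Suc_Suc)
    qed
    then show ?thesis
      unfolding sum_distrib_left
      by (intro sum.reindex_bij_witness[of _ "\<lambda>i. i - 1" "\<lambda>j. j + 1"]) auto
  qed
  ultimately show ?thesis by simp
qed

text \<open>Subtract the integral over \<open>{0..b - 1}\<close> from the full beta integral over
  \<open>{0..b}\<close>; the shifted formula is used with \<open>a = b - 1\<close>.\<close>

lemma integral_power_mult_power_last_unit:
  fixes b :: real
  assumes "1 \<le> b"
  shows "integral {b - 1..b} (\<lambda>x. x ^ k * (b - x) ^ n)
    = fact k * fact n / fact (k + n + 1)
        * (b ^ (k + n + 1) - (\<Sum>i=1..n + 1. real ((k + n + 1) choose (k + i)) * (b - 1) ^ (k + i)))"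
proof -
  let ?f = "\<lambda>x. x ^ k * (b - x) ^ n"
  have "?f integrable_on {0..b}"
    by (intro integrable_continuous_interval continuous_intros)
  from Henstock_Kurzweil_Integration.integral_combine[OF _ _ this, of "b - 1"]
  have "integral {0..b - 1} ?f + integral {b - 1..b} ?f = integral {0..b} ?f"
    using assms by simp
  moreover have "integral {0..b} ?f = fact k * fact n / fact (k + n + 1) * b ^ (k + n + 1)"
    using assms by (intro integral_unique has_integral_power_mult_power) simp
  moreover have "integral {0..b - 1} ?f = fact k * fact n / fact (k + n + 1)
      * (\<Sum>i=1..n + 1. real ((k + n + 1) choose (k + i)) * (b - 1) ^ (k + i))"
    using has_integral_power_mult_power_shift[of "b - 1" k n] assms by (intro integral_unique) simp
  ultimately show ?thesis by (simp only: right_diff_distrib)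
qed

section \<open>Decay of the error term\<close>

text \<open>The number of summands is fixed, and each is a constant times \<open>q ^ k\<close>, with
  \<open>q = (b - 1) / b < 1\<close>, times a binomial coefficient of polynomial growth in
  \<open>k\<close>.\<close>

lemma tendsto_power_ratio_sum_binomial:
  fixes b :: real
  assumes "1 \<le> b"
  shows "(\<lambda>k. (b - 1) ^ k / b ^ (k + n) * (\<Sum>i=1..n. real ((k + n) choose (k + i)) * (b - 1) ^ i))
    \<longlonglongrightarrow> 0"
proof -
  define q where "q = (b - 1) / b"
  have q: "0 \<le> q" "q < 1" using assms by (auto simp: q_def)
  have lim: "(\<lambda>k. q ^ k * real ((k + n) choose (k + i))) \<longlonglongrightarrow> 0" if "i \<le> n" for i
  proof (rule tendsto_sandwich[OF _ _ tendsto_const])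
    show "(\<lambda>k. q ^ k * (real k + real n) ^ n) \<longlonglongrightarrow> 0"
    \<comment> \<open>The case \<open>q = 0\<close> is \<open>b = 1\<close>. There
      \<open>0 ^ 0 = 1\<close> makes the sequence vanish only from \<open>k = 1\<close> on.\<close>
    proof (cases "q = 0")
      case True
      have "\<forall>\<^sub>F k in sequentially. q ^ k * (real k + real n) ^ n = 0"
        using eventually_gt_at_top[of 0] by eventually_elim (simp add: True)
      then show ?thesis by (rule tendsto_eventually)
    next
      case False
      with q have "0 < q" by simp
      with q show ?thesis by real_asymp
    qed
    show "\<forall>\<^sub>F k in sequentially. 0 \<le> q ^ k * real ((k + n) choose (k + i))"
      using q by simp
    show "\<forall>\<^sub>F k in sequentially. q ^ k * real ((k + n) choose (k + i)) \<le> q ^ k * (real k + real n) ^ n"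
      using eventually_gt_at_top[of 0]
    proof eventually_elim
      case (elim k)
      \<comment> \<open>By symmetry the lower index no longer depends on \<open>k\<close>, which
        gives a polynomial bound of fixed degree.\<close>
      have "(k + n) choose (k + i) = (k + n) choose (n - i)"
        using that binomial_symmetric[of "k + i" "k + n"] by simp
      also have "\<dots> \<le> (k + n) ^ (n - i)"
        by (rule binomial_le_pow) (use that in simp)
      also have "\<dots> \<le> (k + n) ^ n"
        using elim by (intro power_increasing) auto
      finally have "real ((k + n) choose (k + i)) \<le> (real k + real n) ^ n"
        by (metis of_nat_le_iff of_nat_power of_nat_add)
      then show ?case using q by (intro mult_left_mono) auto
    qed
  qed
  have "(\<lambda>k. (\<Sum>i=1..n. (b - 1) ^ i / b ^ n * (q ^ k * real ((k + n) choose (k + i))))) \<longlonglongrightarrow> 0"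
    by (intro tendsto_null_sum tendsto_mult_right_zero lim) auto
  also have "(\<lambda>k. (\<Sum>i=1..n. (b - 1) ^ i / b ^ n * (q ^ k * real ((k + n) choose (k + i)))))
      = (\<lambda>k. (b - 1) ^ k / b ^ (k + n) * (\<Sum>i=1..n. real ((k + n) choose (k + i)) * (b - 1) ^ i))"
    by (simp add: q_def power_divide power_add sum_distrib_left mult_ac)
  finally show ?thesis .
qed

theorem proposition3p2:
  fixes r m :: nat
  assumes "r > 0" and "m > 0"
  shows
    "(\<forall>k::nat.
        beta1_sum_moment r k m
          \<le> fact r ^ m / fact (m * r - 1)
              * integral {0..real m} (\<lambda>x. x ^ k * (real m - x) ^ (m * r - 1))
      \<and> fact r ^ m / fact (m * r - 1)
              * integral {0..real m} (\<lambda>x. x ^ k * (real m - x) ^ (m * r - 1))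
          = fact k * fact r ^ m * real m ^ (k + r * m) / fact (k + m * r)
      \<and> beta1_sum_moment r k m
          \<ge> fact r ^ m / fact (m * r - 1)
              * integral {real m - 1..real m} (\<lambda>x. x ^ k * (real m - x) ^ (m * r - 1))
      \<and> fact r ^ m / fact (m * r - 1)
              * integral {real m - 1..real m} (\<lambda>x. x ^ k * (real m - x) ^ (m * r - 1))
          \<ge> fact k * fact r ^ m * real m ^ (k + m * r) / fact (k + m * r)
              * (1 - (real m - 1) ^ k / real m ^ (k + m * r)
                     * (\<Sum>i=1..m * r. real ((k + m * r) choose (k + i)) * (real m - 1) ^ i)))
     \<and> (\<lambda>k. (real m - 1) ^ k / real m ^ (k + m * r)
              * (\<Sum>i=1..m * r. real ((k + m * r) choose (k + i)) * (real m - 1) ^ i))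
         \<longlonglongrightarrow> 0"
proof (intro conjI allI)
  fix k
  let ?n = "m * r - 1"
  have n: "k + ?n + 1 = k + m * r" "?n + 1 = m * r"
    using assms by auto
  show "beta1_sum_moment r k m
      \<le> fact r ^ m / fact ?n * integral {0..real m} (\<lambda>x. x ^ k * (real m - x) ^ ?n)"
    by (rule beta1_sum_moment_le[OF assms])
  show "fact r ^ m / fact ?n * integral {real m - 1..real m} (\<lambda>x. x ^ k * (real m - x) ^ ?n)
      \<le> beta1_sum_moment r k m"
    by (rule beta1_sum_moment_ge[OF assms])
  show "fact r ^ m / fact ?n * integral {0..real m} (\<lambda>x. x ^ k * (real m - x) ^ ?n)
      = fact k * fact r ^ m * real m ^ (k + r * m) / fact (k + m * r)"
    using integral_unique[OF has_integral_power_mult_power[of "real m" k ?n]]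
    by (simp add: n mult.commute[of r m] del: One_nat_def)
  show "fact r ^ m / fact ?n * integral {real m - 1..real m} (\<lambda>x. x ^ k * (real m - x) ^ ?n)
      \<ge> fact k * fact r ^ m * real m ^ (k + m * r) / fact (k + m * r)
          * (1 - (real m - 1) ^ k / real m ^ (k + m * r)
                 * (\<Sum>i=1..m * r. real ((k + m * r) choose (k + i)) * (real m - 1) ^ i))"
    (is "_ \<ge> _ * (1 - ?a ^ k / ?B * ?S)")
  proof (rule eq_refl)
    \<comment> \<open>The common factor \<open>?a ^ k\<close> leaves the sum here;
      \<open>?B\<close>, nonzero as \<open>m > 0\<close>, is factored out afterwards.\<close>
    have "(\<Sum>i=1..m * r. real ((k + m * r) choose (k + i)) * ?a ^ (k + i)) = ?a ^ k * ?S"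
      by (simp add: sum_distrib_left power_add mult_ac)
    then have "integral {real m - 1..real m} (\<lambda>x. x ^ k * (real m - x) ^ ?n)
        = fact k * fact ?n / fact (k + m * r) * (?B - ?a ^ k * ?S)"
      using integral_power_mult_power_last_unit[of "real m" k ?n] assms by (simp only: n)
    moreover have "?B - ?a ^ k * ?S = ?B * (1 - ?a ^ k / ?B * ?S)"
      using assms by (simp add: right_diff_distrib)
    ultimately show "fact k * fact r ^ m * ?B / fact (k + m * r) * (1 - ?a ^ k / ?B * ?S)
        = fact r ^ m / fact ?n * integral {real m - 1..real m} (\<lambda>x. x ^ k * (real m - x) ^ ?n)"
      by simp
  qed
next
  show "(\<lambda>k. (real m - 1) ^ k / real m ^ (k + m * r)
            * (\<Sum>i=1..m * r. real ((k + m * r) choose (k + i)) * (real m - 1) ^ i))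
       \<longlonglongrightarrow> 0"
    using assms by (intro tendsto_power_ratio_sum_binomial) simp
qed

end
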